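(* Let $d\ge 1$. There exists a constant $c_d$, depending only on $d$, such that for every enumeration $v_1,v_2,\dots$ of $\mathbb{Z}^d$ respecting the $\ell^1$-norm, with associated rearrangement $f\mapsto f^*$, for all $1\le p\le\infty$ and all functions $f:\mathbb{Z}^d\to\mathbb{R}$ vanishing at infinity, $$\|\nabla f^*\|_{L^p(\mathbb{Z}^d)}\;\le\;c_d\cdot\|\nabla f\|_{L^p(\mathbb{Z}^d)} .$$
   Context: The lattice graph on $\mathbb{Z}^d$ has an edge $x\sim y$ iff $\|x-y\|_{\ell^1}=1$. For $g:\mathbb{Z}^d\to\mathbb{R}$, $\|\nabla g\|_{L^p}^p:=\sum_{x\sim y}|g(x)-g(y)|^p\in[0,\infty]$ (sum over edges) for $p<\infty$ and $\|\nabla g\|_{L^\infty}:=\sup_{x\sim y}|g(x)-g(y)|$. An enumeration $v_1,v_2,\dots$ of $\mathbb{Z}^d$ (each point listed exactly once) respects the $\ell^1$-norm if $\|v_i\|_{\ell^1}<\|v_j\|_{\ell^1}$ implies $i<j$ (points of equal $\ell^1$ norm may be ordered arbitrarily). A function $f$ vanishes at infinity if $\{x:|f(x)|>t\}$ is finite for every $t>0$. The rearrangement is $f^*(v_k):=$ the $k$-th largest value of $|f|$ counted with multiplicity; precisely $f^*(v_k)=\sup\{t>0:|\{x:|f(x)|>t\}|\ge k\}$, with $\sup\emptyset=0$. *)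

theory Defs
  imports "HOL-Analysis.Analysis"
begin

definition l1_norm :: "int ^ 'd \<Rightarrow> int" where
  "l1_norm x = (\<Sum>i\<in>UNIV. \<bar>x $ i\<bar>)"

(* Edges are unordered pairs, so each edge is counted once in sums. *)
definition lattice_edges :: "(int ^ 'd) set set" where
  "lattice_edges = {{x, y} | x y. l1_norm (x - y) = 1}"

(* |g x - g y| for the edge e = {x, y}, see edge_diff_pair below. *)
definition edge_diff :: "('a \<Rightarrow> real) \<Rightarrow> 'a set \<Rightarrow> real" where
  "edge_diff g e = Max ((\<lambda>(x, y). \<bar>g x - g y\<bar>) ` (e \<times> e))"

lemma edge_diff_pair: "edge_diff g {x, y} = \<bar>g x - g y\<bar>"
proof -
  have "(\<lambda>(x, y). \<bar>g x - g y\<bar>) ` ({x, y} \<times> {x, y}) = {0, \<bar>g x - g y\<bar>}"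
    by (auto simp: abs_minus_commute)
  then show ?thesis by (simp add: edge_diff_def)
qed

(* Powers with exponent r > 0 on [0, \<infinity>]; the library has no powr on ennreal. *)
definition ennreal_rpow :: "ennreal \<Rightarrow> real \<Rightarrow> ennreal" where
  "ennreal_rpow a r = (if a = \<infinity> then \<infinity> else ennreal (enn2real a powr r))"

(* The L^p norm of the gradient, with values in [0, \<infinity>], for 1 \<le> p \<le> \<infinity>. *)
definition grad_norm :: "ennreal \<Rightarrow> (int ^ 'd \<Rightarrow> real) \<Rightarrow> ennreal" where
  "grad_norm p g =
    (if p = \<infinity> then (SUP e\<in>lattice_edges. ennreal (edge_diff g e))
     else ennreal_rpow
       (\<integral>\<^sup>+ e. ennreal (edge_diff g e powr enn2real p) \<partial>count_space lattice_edges)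
       (1 / enn2real p))"

(* Enumerations are indexed from 1; the value v 0 is irrelevant. *)
definition l1_enumeration :: "(nat \<Rightarrow> int ^ 'd) \<Rightarrow> bool" where
  "l1_enumeration v \<longleftrightarrow> bij_betw v {1..} UNIV \<and>
     (\<forall>i\<ge>1. \<forall>j\<ge>1. l1_norm (v i) < l1_norm (v j) \<longrightarrow> i < j)"

definition vanishes_at_infinity :: "('a \<Rightarrow> real) \<Rightarrow> bool" where
  "vanishes_at_infinity f \<longleftrightarrow> (\<forall>t>0. finite {x. \<bar>f x\<bar> > t})"

(* The k-th largest value of |f| (k \<ge> 1), counted with multiplicity. Only meaningful for f
   vanishing at infinity: then all the level sets are finite, so card is their true size, and
   f is bounded, so the supremum exists. Sup {} is unspecified on real, hence the case split. *)
definition kth_largest :: "('a \<Rightarrow> real) \<Rightarrow> nat \<Rightarrow> real" where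
  "kth_largest f k =
    (let T = {t. t > 0 \<and> card {x. \<bar>f x\<bar> > t} \<ge> k} in if T = {} then 0 else Sup T)"

definition rearrangement ::
    "(nat \<Rightarrow> int ^ 'd) \<Rightarrow> (int ^ 'd \<Rightarrow> real) \<Rightarrow> int ^ 'd \<Rightarrow> real" where
  "rearrangement v f x = kth_largest f (inv_into {1..} v x)"

lemma rearrangement_enum:
  assumes "l1_enumeration v" "k \<ge> 1"
  shows "rearrangement v f (v k) = kth_largest f k"
  using assms by (simp add: rearrangement_def l1_enumeration_def bij_betw_def inv_into_f_f)

end

theory Submission
  imports Defs
begin

text \<open>
  Let \<open>a\<close> be the decreasing list of values of \<open>|f|\<close> and \<open>b s\<close> its entry at the cardinality of the
  \<open>\<ell>\<^sup>1\<close> ball of radius \<open>s\<close>. Along an edge of \<open>f\<^sup>*\<close> at height \<open>r\<close> the values differ by at most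
  \<open>b (r - 1) - b (r + 1)\<close>, and there are at most about \<open>r ^ (d - 1)\<close> such edges. Conversely, a set
  with roughly as many points as the ball of radius \<open>s\<close> has at least a constant times \<open>s ^ (d - 1)\<close>
  boundary vertices. If one moves down in \<open>a\<close> by half that many places, half of the boundary of a
  superlevel set lies below the new level, so the truncation of \<open>|f|\<close> to \<open>[b (s + 1), b s]\<close> drops by
  a fixed fraction of \<open>b s - b (s + 1)\<close> on about \<open>s ^ (d - 1)\<close> edges. The gradients of these
  truncations add up to at most the gradient of \<open>f\<close> on each edge, and \<open>t \<mapsto> t powr p\<close> is
  superadditive on the nonnegative reals for \<open>p \<ge> 1\<close>, so the estimates can be summed over \<open>s\<close> with
  a constant that is uniform in \<open>p\<close>.
\<close>

section \<open>Lattice points in boxes, balls and spheres\<close>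

lemma card_box:
  fixes S :: "'d::finite \<Rightarrow> int set"
  assumes "\<And>i. finite (S i)"
  shows "finite {x :: int ^ 'd. \<forall>i. x $ i \<in> S i}"
    and "card {x :: int ^ 'd. \<forall>i. x $ i \<in> S i} = (\<Prod>i\<in>UNIV. card (S i))"
proof -
  have "bij_betw vec_lambda (PiE UNIV S) {x :: int ^ 'd. \<forall>i. x $ i \<in> S i}"
    by (rule bij_betw_byWitness[where f' = vec_nth]) (auto simp: PiE_def Pi_def)
  moreover have "finite (PiE UNIV S)"
    using assms by (intro finite_PiE) auto
  ultimately show "finite {x :: int ^ 'd. \<forall>i. x $ i \<in> S i}"
    and "card {x :: int ^ 'd. \<forall>i. x $ i \<in> S i} = (\<Prod>i\<in>UNIV. card (S i))"
    using bij_betw_same_card[of vec_lambda "PiE UNIV S" "{x :: int ^ 'd. \<forall>i. x $ i \<in> S i}"]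
      bij_betw_finite[of vec_lambda "PiE UNIV S" "{x :: int ^ 'd. \<forall>i. x $ i \<in> S i}"]
    by (auto simp: card_PiE)
qed

lemma l1_norm_nonneg [simp]: "0 \<le> l1_norm (x :: int ^ 'd::finite)"
  by (simp add: l1_norm_def sum_nonneg)

lemma l1_norm_triangle: "l1_norm (x + y) \<le> l1_norm x + l1_norm (y :: int ^ 'd::finite)"
  unfolding l1_norm_def sum.distrib[symmetric] by (intro sum_mono) auto

lemma l1_norm_minus_commute: "l1_norm (x - y) = l1_norm (y - x :: int ^ 'd::finite)"
  by (simp add: l1_norm_def abs_minus_commute)

lemma l1_norm_zero_iff [simp]: "l1_norm x = 0 \<longleftrightarrow> x = (0 :: int ^ 'd::finite)"
  by (auto simp: l1_norm_def sum_nonneg_eq_0_iff vec_eq_iff)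

lemma l1_norm_0 [simp]: "l1_norm (0 :: int ^ 'd::finite) = 0"
  by simp

lemma l1_norm_le_0_iff [simp]: "l1_norm x \<le> 0 \<longleftrightarrow> x = (0 :: int ^ 'd::finite)"
  using l1_norm_nonneg[of x] l1_norm_zero_iff[of x] by linarith

lemma component_le_l1_norm: "\<bar>x $ i\<bar> \<le> l1_norm (x :: int ^ 'd::finite)"
  unfolding l1_norm_def by (rule member_le_sum) auto

lemma l1_norm_axis: "l1_norm (axis i a :: int ^ 'd::finite) = \<bar>a\<bar>"
proof -
  have "l1_norm (axis i a :: int ^ 'd) = (\<Sum>j\<in>UNIV. if j = i then \<bar>a\<bar> else 0)"
    unfolding l1_norm_def axis_def by (intro sum.cong) auto
  then show ?thesis by simp
qed

definition l1_ball :: "nat \<Rightarrow> (int ^ 'd::finite) set" where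
  "l1_ball n = {x. l1_norm x \<le> int n}"

definition l1_sphere :: "nat \<Rightarrow> (int ^ 'd::finite) set" where
  "l1_sphere n = {x. l1_norm x = int n}"

lemma l1_ball_subset_box:
  "l1_ball n \<subseteq> {x :: int ^ 'd::finite. \<forall>i. x $ i \<in> {- int n..int n}}"
proof (clarsimp simp: l1_ball_def)
  fix x :: "int ^ 'd" and i assume "l1_norm x \<le> int n"
  then show "- int n \<le> x $ i \<and> x $ i \<le> int n"
    using component_le_l1_norm[of x i] by linarith
qed

lemma finite_l1_ball [simp]: "finite (l1_ball n :: (int ^ 'd::finite) set)"
  by (rule finite_subset[OF l1_ball_subset_box]) (rule card_box, simp)

lemma card_l1_ball_le: "card (l1_ball n :: (int ^ 'd::finite) set) \<le> (2 * n + 1) ^ CARD('d)"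
proof -
  have "card (l1_ball n :: (int ^ 'd) set)
      \<le> card {x :: int ^ 'd. \<forall>i. x $ i \<in> {- int n..int n}}"
    by (rule card_mono[OF _ l1_ball_subset_box]) (rule card_box, simp)
  also have "\<dots> = (2 * n + 1) ^ CARD('d)"
    by (subst card_box) (auto simp: nat_add_distrib nat_mult_distrib)
  finally show ?thesis .
qed

text \<open>The cube with all coordinates in \<open>{0..n div d}\<close>, where
  \<open>d = CARD('d)\<close>, lies in the ball, and \<open>n + 1\<close> is at most
  \<open>d\<close> times its side. The bound is multiplied out to stay within the naturals.\<close>

lemma card_l1_ball_ge:
  "(n + 1) ^ CARD('d) \<le> CARD('d) ^ CARD('d) * card (l1_ball n :: (int ^ 'd::finite) set)"
proof -
  define d where "d = CARD('d)"
  have d: "d > 0" by (simp add: d_def)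
  define q where "q = n div d"
  have "{x :: int ^ 'd. \<forall>i. x $ i \<in> {0..int q}} \<subseteq> l1_ball n"
  proof
    fix x :: "int ^ 'd" assume "x \<in> {x. \<forall>i. x $ i \<in> {0..int q}}"
    then have "l1_norm x \<le> (\<Sum>i\<in>(UNIV::'d set). int q)"
      unfolding l1_norm_def by (intro sum_mono) auto
    also have "\<dots> = int (d * q)" by (simp add: d_def)
    also have "\<dots> \<le> int n" unfolding q_def by (subst of_nat_le_iff) simp
    finally show "x \<in> l1_ball n" by (simp add: l1_ball_def)
  qed
  then have "card {x :: int ^ 'd. \<forall>i. x $ i \<in> {0..int q}} \<le> card (l1_ball n :: (int ^ 'd) set)"
    by (intro card_mono) auto
  then have 1: "(q + 1) ^ d \<le> card (l1_ball n :: (int ^ 'd) set)"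
    by (subst (asm) card_box) (auto simp: nat_add_distrib d_def)
  have "n = d * q + n mod d" by (simp add: q_def)
  moreover have "n mod d < d" using d by simp
  ultimately have "n + 1 \<le> d * (q + 1)" by (simp add: algebra_simps)
  then have "(n + 1) ^ d \<le> d ^ d * (q + 1) ^ d"
    by (subst power_mult_distrib[symmetric]) (rule power_mono, auto)
  also have "\<dots> \<le> d ^ d * card (l1_ball n :: (int ^ 'd) set)"
    using 1 by (rule mult_left_mono) simp
  finally show ?thesis by (simp add: d_def)
qed

lemma card_l1_ball_pos: "0 < card (l1_ball n :: (int ^ 'd::finite) set)"
proof -
  have "0 \<in> (l1_ball n :: (int ^ 'd) set)" by (simp add: l1_ball_def)
  then show ?thesis by (auto simp: card_gt_0_iff)
qed

lemma card_l1_ball_0: "card (l1_ball 0 :: (int ^ 'd::finite) set) = 1"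
proof -
  have "l1_ball 0 = {0 :: int ^ 'd}"
    by (auto simp: l1_ball_def)
  then show ?thesis by simp
qed

lemma l1_sphere_subset_ball: "l1_sphere n \<subseteq> l1_ball n"
  by (auto simp: l1_ball_def l1_sphere_def)

lemma finite_l1_sphere [simp]: "finite (l1_sphere n :: (int ^ 'd::finite) set)"
  by (rule finite_subset[OF l1_sphere_subset_ball]) simp

lemma card_l1_ball_Suc:
  "card (l1_ball (Suc n) :: (int ^ 'd::finite) set) =
    card (l1_ball n :: (int ^ 'd) set) + card (l1_sphere (Suc n) :: (int ^ 'd) set)"
proof -
  have "l1_ball (Suc n) = (l1_ball n \<union> l1_sphere (Suc n) :: (int ^ 'd) set)"
    by (auto simp: l1_ball_def l1_sphere_def)
  moreover have "l1_ball n \<inter> l1_sphere (Suc n) = ({} :: (int ^ 'd) set)"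
    by (auto simp: l1_ball_def l1_sphere_def)
  ultimately show ?thesis by (simp add: card_Un_disjoint)
qed

lemma card_l1_ball_mono: 
  "m \<le> n \<Longrightarrow> card (l1_ball m :: (int ^ 'd::finite) set) \<le> card (l1_ball n :: (int ^ 'd) set)"
  by (rule card_mono, simp) (auto simp: l1_ball_def)

text \<open>All coordinates but one determine the remaining one up to its sign.\<close>

lemma card_l1_sphere_le:
  "card (l1_sphere n :: (int ^ 'd::finite) set) \<le> 2 * (2 * n + 1) ^ (CARD('d) - 1)"
proof -
  \<comment> \<open>An arbitrary coordinate; \<open>h\<close> keeps only the sign of it.\<close>
  define j :: 'd where "j = undefined"
  define S :: "'d \<Rightarrow> int set" where "S i = (if i = j then {0..1} else {- int n..int n})" for i
  define h :: "int ^ 'd \<Rightarrow> int ^ 'd"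
    where "h x = (\<chi> i. if i = j then (if x $ i \<ge> 0 then 1 else 0) else x $ i)" for x
  have split: "l1_norm x = \<bar>x $ j\<bar> + (\<Sum>i\<in>UNIV - {j}. \<bar>x $ i\<bar>)" for x :: "int ^ 'd"
    unfolding l1_norm_def by (subst sum.remove[of _ j]) auto
  have "inj_on h (l1_sphere n)"
  proof (rule inj_onI)
    fix x y assume x: "x \<in> l1_sphere n" and y: "y \<in> l1_sphere n" and "h x = h y"
    then have eq: "h x $ i = h y $ i" for i by simp
    have off: "x $ i = y $ i" if "i \<noteq> j" for i
      using eq[of i] that by (simp add: h_def)
    then have "(\<Sum>i\<in>UNIV - {j}. \<bar>x $ i\<bar>) = (\<Sum>i\<in>UNIV - {j}. \<bar>y $ i\<bar>)"
      by (intro sum.cong) auto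
    then have "\<bar>x $ j\<bar> = \<bar>y $ j\<bar>"
      using x y split[of x] split[of y] by (simp add: l1_sphere_def)
    moreover have "x $ j \<ge> 0 \<longleftrightarrow> y $ j \<ge> 0"
      using eq[of j] by (simp add: h_def split: if_splits)
    ultimately have "x $ j = y $ j" by linarith
    with off show "x = y" by (metis vec_eq_iff)
  qed
  moreover have "h ` l1_sphere n \<subseteq> {x. \<forall>i. x $ i \<in> S i}"
    using l1_sphere_subset_ball l1_ball_subset_box
    by (fastforce simp: h_def S_def)
  ultimately have "card (l1_sphere n :: (int ^ 'd) set) \<le> card {x :: int ^ 'd. \<forall>i. x $ i \<in> S i}"
    by (rule card_inj_on_le) (rule card_box, simp add: S_def)
  also have "\<dots> = (\<Prod>i\<in>UNIV. card (S i))"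
    by (rule card_box) (simp add: S_def)
  also have "\<dots> = card (S j) * (\<Prod>i\<in>UNIV - {j}. card (S i))"
    by (rule prod.remove) auto
  also have "(\<Prod>i\<in>UNIV - {j}. card (S i)) = (\<Prod>i\<in>UNIV - {j}. 2 * n + 1)"
    by (intro prod.cong) (auto simp: S_def nat_add_distrib nat_mult_distrib)
  also have "card (S j) = 2" by (simp add: S_def)
  finally show ?thesis by (simp add: card_Diff_singleton)
qed

section \<open>Vertex boundary and isoperimetric inequality\<close>

definition vertex_boundary :: "(int ^ 'd::finite) set \<Rightarrow> (int ^ 'd) set" where
  "vertex_boundary A = {y. y \<notin> A \<and> (\<exists>x\<in>A. l1_norm (x - y) = 1)}"

lemma finite_vertex_boundary:
  assumes "finite A" shows "finite (vertex_boundary A)"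
proof (rule finite_subset)
  show "vertex_boundary A \<subseteq> (\<lambda>(x, u). x - u) ` (A \<times> l1_sphere 1)"
    by (force simp: vertex_boundary_def l1_sphere_def image_iff)
qed (use assms in auto)

definition exits :: "'a::plus set \<Rightarrow> 'a \<Rightarrow> 'a set" where
  "exits A g = {x \<in> A. x + g \<notin> A}"

text \<open>A point that leaves \<open>A\<close> under \<open>g + h\<close> either leaves already
  under \<open>g\<close>, or its translate by \<open>g\<close> is a point of \<open>A\<close> that
  leaves under \<open>h\<close>. This reduces long translations to unit steps.\<close>

lemma card_exits_add:
  fixes A :: "'a::cancel_semigroup_add set"
  assumes A: "finite A"
  shows "card (exits A (g + h)) \<le> card (exits A g) + card (exits A h)"
proof -
  have fin: "finite (exits A g)" for g using A by (simp add: exits_def)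
  have "(\<lambda>x. x + g) ` (exits A (g + h) - exits A g) \<subseteq> exits A h"
    by (auto simp: exits_def add.assoc)
  then have "card (exits A (g + h) - exits A g) \<le> card (exits A h)"
    by (rule card_inj_on_le[rotated]) (auto intro: inj_onI fin)
  moreover have "card (exits A (g + h)) \<le> card (exits A g) + card (exits A (g + h) - exits A g)"
    by (rule order.trans[OF card_mono card_Un_le]) (auto intro: fin)
  ultimately show ?thesis by linarith
qed

lemma exits_0 [simp]: "exits A (0 :: 'a::monoid_add) = {}"
  by (auto simp: exits_def)

text \<open>A unit step maps the points that it takes out of \<open>A\<close> injectively into the
  vertex boundary; \<open>n\<close> such steps cost at most \<open>n\<close> times as much.\<close>

lemma card_exits_axis:
  fixes A :: "(int ^ 'd::finite) set"
  assumes A: "finite A"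
  shows "card (exits A (axis i (int n))) \<le> n * card (vertex_boundary A)"
proof (induction n)
  case 0
  have "axis i 0 = (0 :: int ^ 'd)" by (simp add: axis_def vec_eq_iff)
  then show ?case by (simp only: of_nat_0 exits_0) simp
next
  case (Suc n)
  have "(\<lambda>x. x + axis i 1) ` exits A (axis i 1) \<subseteq> vertex_boundary A"
    by (force simp: exits_def vertex_boundary_def l1_norm_minus_commute[of _ "_ + _"] l1_norm_axis)
  then have 1: "card (exits A (axis i 1)) \<le> card (vertex_boundary A)"
    by (rule card_inj_on_le[rotated]) (auto intro: inj_onI finite_vertex_boundary A)
  have "axis i (int (Suc n)) = axis i 1 + (axis i (int n) :: int ^ 'd)"
    by (auto simp: axis_def vec_eq_iff)
  then have "card (exits A (axis i (int (Suc n))))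
      \<le> card (exits A (axis i 1)) + card (exits A (axis i (int n)))"
    using card_exits_add[OF A, of "axis i 1"] by metis
  with 1 Suc show ?case by simp
qed

text \<open>The translation by \<open>g\<close> is a walk along one coordinate axis after another,
  of total length \<open>l1_norm g\<close>.\<close>

lemma card_exits_le:
  fixes A :: "(int ^ 'd::finite) set"
  assumes A: "finite A" and g: "\<And>i. 0 \<le> g $ i"
  shows "card (exits A g) \<le> nat (l1_norm g) * card (vertex_boundary A)"
proof -
  have *: "card (exits A (\<Sum>i\<in>I. axis i (g $ i)))
      \<le> (\<Sum>i\<in>I. nat (g $ i)) * card (vertex_boundary A)" if "finite I" for I
    using that
  proof (induction I)
    case (insert i I)
    have "card (exits A (axis i (g $ i))) \<le> nat (g $ i) * card (vertex_boundary A)"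
      using card_exits_axis[OF A, of i "nat (g $ i)"] g by simp
    with insert card_exits_add[OF A, of "axis i (g $ i)" "\<Sum>i\<in>I. axis i (g $ i)"]
    show ?case by (simp add: add_mult_distrib)
  qed simp
  have "(\<Sum>i\<in>UNIV. axis i (g $ i)) = g"
    by (simp add: vec_eq_iff axis_def)
  moreover have "int (\<Sum>i\<in>UNIV. nat (g $ i)) = l1_norm g"
    using g by (simp add: l1_norm_def)
  then have "(\<Sum>i\<in>UNIV. nat (g $ i)) = nat (l1_norm g)"
    by linarith
  ultimately show ?thesis using *[of UNIV] by simp
qed

text \<open>Averaging over the translations in a cube of side \<open>n\<close>: as a translation is determined by
  one point and its image, at most half of all (point, translation) pairs can stay inside \<open>A\<close>.\<close>

lemma isoperimetric_inequality:
  fixes A :: "(int ^ 'd::finite) set"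
  assumes A: "finite A" and n: "2 * card A \<le> n ^ CARD('d)"
  shows "card A \<le> 2 * CARD('d) * n * card (vertex_boundary A)"
proof (cases "A = {}")
  case False
  define S where "S = {x :: int ^ 'd. \<forall>i. x $ i \<in> {0..<int n}}"
  have finS: "finite S" unfolding S_def by (rule card_box) simp
  have cardS: "card S = n ^ CARD('d)" unfolding S_def by (subst card_box) auto
  let ?b = "card (vertex_boundary A)"
  have ex: "card (exits A g) \<le> CARD('d) * n * ?b" if "g \<in> S" for g
  proof -
    have "l1_norm g \<le> (\<Sum>i\<in>(UNIV::'d set). int n)"
      unfolding l1_norm_def using that by (intro sum_mono) (auto simp: S_def less_imp_le)
    then have "l1_norm g \<le> int (CARD('d) * n)" by simp
    then have "nat (l1_norm g) \<le> CARD('d) * n" by (simp only: nat_le_iff)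
    moreover have "card (exits A g) \<le> nat (l1_norm g) * ?b"
      using that by (intro card_exits_le A) (auto simp: S_def)
    ultimately show ?thesis by (meson le_trans mult_le_mono1)
  qed
  define P where "P = (SIGMA g:S. {x \<in> A. x + g \<in> A})"
  have "card P \<le> card (A \<times> A)"
    by (rule card_inj_on_le[of "\<lambda>(g, x). (x, x + g)"]) (auto simp: P_def inj_on_def A)
  then have P: "card P \<le> card A * card A" by (simp add: card_cartesian_product)
  have "card S * card A = (\<Sum>g\<in>S. card A)" by simp
  also have "\<dots> = (\<Sum>g\<in>S. card (exits A g) + card {x \<in> A. x + g \<in> A})"
  proof (rule sum.cong)
    fix g
    have "A = exits A g \<union> {x \<in> A. x + g \<in> A}" by (auto simp: exits_def)
    then have "card A = card (exits A g \<union> {x \<in> A. x + g \<in> A})" by simp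
    also have "\<dots> = card (exits A g) + card {x \<in> A. x + g \<in> A}"
      by (rule card_Un_disjoint) (use A in \<open>auto simp: exits_def\<close>)
    finally show "card A = \<dots>" .
  qed simp
  also have "\<dots> = (\<Sum>g\<in>S. card (exits A g)) + card P"
    using A finS by (simp add: sum.distrib P_def)
  also have "\<dots> \<le> card S * (CARD('d) * n * ?b) + card A * card A"
    using sum_bounded_above[of S "\<lambda>g. card (exits A g)", OF ex] P by (intro add_mono) auto
  \<comment> \<open>The hypothesis on \<open>n\<close> says that \<open>card S\<close> is at least
    \<open>2 * card A\<close>, so the pairs that stay inside take up at most half of
    \<open>card S * card A\<close> and can be absorbed on the left.\<close>
  finally have "2 * (card S * card A) \<le> card S * (2 * CARD('d) * n * ?b) + 2 * card A * card A"
    by (simp add: algebra_simps)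
  moreover have "2 * card A * card A \<le> card S * card A"
    using n by (simp add: cardS)
  ultimately have "card S * card A \<le> card S * (2 * CARD('d) * n * ?b)" by linarith
  moreover have "card S > 0"
  proof -
    have "card A > 0" using False A by (simp add: card_gt_0_iff)
    then show ?thesis using n unfolding cardS by linarith
  qed
  ultimately show ?thesis by simp
qed simp

section \<open>Ordered values and superlevel sets\<close>

lemma vanishes_at_infinityD:
  "vanishes_at_infinity f \<Longrightarrow> 0 < t \<Longrightarrow> finite {x. t < \<bar>f x\<bar>}"
  by (simp add: vanishes_at_infinity_def)

text \<open>Replaces the supremum by counting, which is how the order properties of
  \<open>kth_largest\<close> are obtained. The strict inequality is possible because
  \<open>|f|\<close> takes only finitely many values above \<open>t\<close>, so the superlevel set
  stays the same slightly above \<open>t\<close>.\<close>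

lemma less_kth_largest_iff:
  assumes f: "vanishes_at_infinity f" and k: "1 \<le> k" and t: "0 < t"
  shows "t < kth_largest f k \<longleftrightarrow> k \<le> card {x. t < \<bar>f x\<bar>}"
proof -
  define T where "T = {t. t > 0 \<and> card {x. \<bar>f x\<bar> > t} \<ge> k}"
  have kth: "kth_largest f k = (if T = {} then 0 else Sup T)"
    unfolding kth_largest_def Let_def T_def by (rule refl)
  note fin = vanishes_at_infinityD[OF f]
  have bdd: "bdd_above T"
  proof (rule bdd_aboveI)
    fix s assume s: "s \<in> T"
    \<comment> \<open>A crude bound for \<open>|f|\<close>: each value is at most 1 or a summand on
      the right.\<close>
    show "s \<le> 1 + (\<Sum>x\<in>{x. 1 < \<bar>f x\<bar>}. \<bar>f x\<bar>)"
    proof (rule ccontr)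
      assume *: "\<not> ?thesis"
      have nn: "0 \<le> (\<Sum>x\<in>{x. 1 < \<bar>f x\<bar>}. \<bar>f x\<bar>)" by (rule sum_nonneg) simp
      have "card {x. s < \<bar>f x\<bar>} \<noteq> 0" using s k by (auto simp: T_def)
      then have "{x. s < \<bar>f x\<bar>} \<noteq> {}" by (metis card.empty)
      then obtain x where x: "s < \<bar>f x\<bar>" by auto
      then have "x \<in> {x. 1 < \<bar>f x\<bar>}" using * nn by (simp only: mem_Collect_eq)
      then have "\<bar>f x\<bar> \<le> (\<Sum>x\<in>{x. 1 < \<bar>f x\<bar>}. \<bar>f x\<bar>)"
        using fin[of 1] by (intro member_le_sum) auto
      then show False using x * by linarith
    qed
  qed
  show ?thesis
  proof
    assume "t < kth_largest f k"
    with t have ne: "T \<noteq> {}" and "t < Sup T" by (auto simp: kth split: if_splits)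
    then obtain s where s: "s \<in> T" "t < s" using less_cSup_iff[OF ne bdd] by auto
    then have "{x. s < \<bar>f x\<bar>} \<subseteq> {x. t < \<bar>f x\<bar>}" by auto
    then have "card {x. s < \<bar>f x\<bar>} \<le> card {x. t < \<bar>f x\<bar>}" by (rule card_mono[OF fin[OF t]])
    then show "k \<le> card {x. t < \<bar>f x\<bar>}" using s by (auto simp: T_def)
  next
    assume c: "k \<le> card {x. t < \<bar>f x\<bar>}"
    define V where "V = (\<lambda>x. \<bar>f x\<bar>) ` {x. t < \<bar>f x\<bar>}"
    have "card {x. t < \<bar>f x\<bar>} \<noteq> 0" using c k by linarith
    then have "{x. t < \<bar>f x\<bar>} \<noteq> {}" by (metis card.empty)
    then have V: "finite V" "V \<noteq> {}" using fin[OF t] by (auto simp: V_def)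
    \<comment> \<open>No value of \<open>|f|\<close> lies strictly between \<open>t\<close> and
      \<open>Min V\<close>, so \<open>s\<close> has the same superlevel set as \<open>t\<close> and
      belongs to \<open>T\<close>.\<close>
    define s where "s = (t + Min V) / 2"
    have "t < Min V" using V by (auto simp: V_def)
    then have s: "t < s" "s < Min V" by (auto simp: s_def)
    have "{x. t < \<bar>f x\<bar>} = {x. s < \<bar>f x\<bar>}"
    proof (intro equalityI subsetI)
      fix x assume "x \<in> {x. t < \<bar>f x\<bar>}"
      then have "Min V \<le> \<bar>f x\<bar>" using V by (intro Min_le) (auto simp: V_def)
      then show "x \<in> {x. s < \<bar>f x\<bar>}" using s by auto
    qed (use s in auto)
    then have "s \<in> T" using s t c by (simp add: T_def)
    then show "t < kth_largest f k" using cSup_upper[OF _ bdd, of s] s by (auto simp: kth)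
  qed
qed

lemma kth_largest_nonneg: "0 \<le> kth_largest f k" if "vanishes_at_infinity f" "1 \<le> k"
proof (rule ccontr)
  assume neg: "\<not> ?thesis"
  then obtain t where "0 < t" "k \<le> card {x. t < \<bar>f x\<bar>}"
    by (auto simp: kth_largest_def Let_def split: if_splits)
  then have "t < kth_largest f k" using less_kth_largest_iff[OF that] by blast
  with neg \<open>0 < t\<close> show False by simp
qed

lemma kth_largest_antimono:
  assumes f: "vanishes_at_infinity f" and k: "1 \<le> k" "k \<le> l"
  shows "kth_largest f l \<le> kth_largest f k"
proof (rule ccontr)
  assume *: "\<not> ?thesis"
  define t where "t = (kth_largest f l + kth_largest f k) / 2"
  have t: "kth_largest f k < t" "t < kth_largest f l" using * by (auto simp: t_def)
  have "0 < t" using t kth_largest_nonneg[OF f k(1)] by linarith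
  then show False
    using t k less_kth_largest_iff[OF f k(1), of t] less_kth_largest_iff[OF f _, of l t] by auto
qed

section \<open>Edges across a gap between two levels\<close>

text \<open>Each boundary vertex outside \<open>B\<close> is joined to one chosen neighbour in
  \<open>A\<close>. These edges are distinct, since each has just one endpoint outside
  \<open>B\<close>, and at most \<open>card B - card A\<close> boundary vertices are lost in
  \<open>B\<close>.\<close>

lemma boundary_edges:
  fixes A B :: "(int ^ 'd::finite) set"
  assumes A: "finite A" and B: "finite B" and "A \<subseteq> B"
  shows "\<exists>F \<subseteq> lattice_edges. finite F \<and> card (vertex_boundary A) + card A \<le> card F + card B \<and>
    (\<forall>e\<in>F. \<exists>x\<in>A. \<exists>y. y \<notin> B \<and> e = {x, y})"
proof -
  let ?Y = "vertex_boundary A - B"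
  have "\<forall>y\<in>?Y. \<exists>x. x \<in> A \<and> l1_norm (x - y) = 1" by (auto simp: vertex_boundary_def)
  then obtain h where h: "\<And>y. y \<in> ?Y \<Longrightarrow> h y \<in> A \<and> l1_norm (h y - y) = 1" by metis
  define F where "F = (\<lambda>y. {h y, y}) ` ?Y"
  have fin: "finite (vertex_boundary A)" using A by (rule finite_vertex_boundary)
  have "inj_on (\<lambda>y. {h y, y}) ?Y"
  proof (rule inj_onI)
    fix y z assume *: "y \<in> ?Y" "z \<in> ?Y" "{h y, y} = {h z, z}"
    then have "y \<noteq> h z" using h[of z] \<open>A \<subseteq> B\<close> by auto
    with * show "y = z" by auto
  qed
  then have "card F = card ?Y" unfolding F_def by (rule card_image)
  moreover have "card (vertex_boundary A) \<le> card (?Y \<union> (B - A))"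
    using fin B by (intro card_mono) (auto simp: vertex_boundary_def)
  moreover have "card (?Y \<union> (B - A)) \<le> card ?Y + card (B - A)" by (rule card_Un_le)
  moreover have "card (B - A) + card A = card B"
    using assms by (metis card_Diff_subset card_mono le_add_diff_inverse2)
  ultimately have "card (vertex_boundary A) + card A \<le> card F + card B" by linarith
  moreover have "F \<subseteq> lattice_edges" using h by (auto simp: F_def lattice_edges_def)
  moreover have "\<forall>e\<in>F. \<exists>x\<in>A. \<exists>y. y \<notin> B \<and> e = {x, y}" using h by (auto simp: F_def)
  ultimately show ?thesis using fin by (intro exI[of _ F]) (auto simp: F_def)
qed

text \<open>With \<open>d = CARD('d)\<close>, the product of \<open>d ^ d\<close> from the lower
  bound for the ball and \<open>12 * d\<close> from the isoperimetric inequality.\<close>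

definition iso_const :: "'d::finite itself \<Rightarrow> nat" where
  "iso_const _ = 12 * CARD('d) ^ (CARD('d) + 1)"

lemma iso_const_pos: "0 < iso_const TYPE('d::finite)"
  by (simp add: iso_const_def)

text \<open>The volume of \<open>A\<close> is of order \<open>(s + 1) ^ d\<close>, and a cube of
  side of order \<open>s + 1\<close> suffices in the isoperimetric inequality, so one factor
  \<open>s + 1\<close> cancels.\<close>

lemma card_vertex_boundary_ge:
  fixes A :: "(int ^ 'd::finite) set"
  assumes A: "finite A"
    and lo: "card (l1_ball s :: (int ^ 'd) set) \<le> card A"
    and hi: "card A \<le> card (l1_ball (s + 1) :: (int ^ 'd) set)"
  shows "(s + 1) ^ (CARD('d) - 1) \<le> iso_const TYPE('d) * card (vertex_boundary A)"
proof -
  define d where "d = CARD('d)"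
  have d: "d = Suc (d - 1)" by (simp add: d_def)
  let ?b = "card (vertex_boundary A)"
  \<comment> \<open>The ball of radius \<open>s + 1\<close> fits into a cube of side
    \<open>2 * s + 3\<close>; doubling the side gains at least the factor 2 that the isoperimetric
    inequality requires.\<close>
  define n where "n = 2 * (2 * s + 3)"
  have "2 * card A \<le> 2 * (2 * s + 3) ^ d"
    using hi card_l1_ball_le[where 'd = 'd, of "s + 1"] by (simp add: d_def algebra_simps numeral_eq_Suc)
  also have "\<dots> \<le> 2 ^ d * (2 * s + 3) ^ d"
    by (rule mult_right_mono) (subst d, simp_all)
  finally have "2 * card A \<le> n ^ d" unfolding n_def power_mult_distrib .
  then have "card A \<le> 2 * d * n * ?b"
    unfolding d_def by (rule isoperimetric_inequality[OF A])
  also have "\<dots> \<le> 2 * d * (6 * (s + 1)) * ?b"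
    by (intro mult_right_mono mult_left_mono) (auto simp: n_def)
  finally have 1: "card A \<le> 12 * d * (s + 1) * ?b" by (simp add: algebra_simps)
  have "(s + 1) * (s + 1) ^ (d - 1) = (s + 1) ^ d" by (subst (2) d) (simp only: power_Suc)
  also have "\<dots> \<le> d ^ d * card A"
    using card_l1_ball_ge[where 'd = 'd, of s] lo unfolding d_def
    by (meson le_trans mult_le_mono2)
  also have "\<dots> \<le> d ^ d * (12 * d * (s + 1) * ?b)" using 1 by (rule mult_left_mono) simp
  also have "\<dots> = (s + 1) * (iso_const TYPE('d) * ?b)"
    by (simp add: iso_const_def d_def algebra_simps)
  finally show ?thesis unfolding d_def by (subst (asm) mult_le_cancel1) simp
qed

definition truncate :: "real \<Rightarrow> real \<Rightarrow> real \<Rightarrow> real" where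
  "truncate l u x = max l (min u x)"

lemma edge_diff_nonneg: "e \<in> lattice_edges \<Longrightarrow> 0 \<le> edge_diff g e"
  by (auto simp: lattice_edges_def edge_diff_pair)

text \<open>For \<open>f\<close> vanishing at infinity, the least value of the rearrangement on the
  ball of radius \<open>s\<close>, whatever the enumeration.\<close>

definition shell_value :: "(int ^ 'd::finite \<Rightarrow> real) \<Rightarrow> nat \<Rightarrow> real" where
  "shell_value f s = kth_largest f (card (l1_ball s :: (int ^ 'd) set))"

lemma one_le_card_l1_ball: "1 \<le> card (l1_ball s :: (int ^ 'd::finite) set)"
  using card_l1_ball_pos[where 'd = 'd, of s] by linarith

lemma shell_value_antimono:
  "vanishes_at_infinity f \<Longrightarrow> s \<le> r \<Longrightarrow> shell_value f r \<le> shell_value f s"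
  unfolding shell_value_def
  by (intro kth_largest_antimono card_l1_ball_mono one_le_card_l1_ball)

text \<open>Edges from \<open>k\<close> points above a threshold \<open>t\<close> to points outside
  the superlevel set of a lower threshold \<open>u\<close> cross the middle half of the gap.
  Truncation to \<open>L\<close> and \<open>U\<close> preserves this drop, as the gap lies between
  them.\<close>

lemma level_gap_edges:
  fixes f :: "int ^ 'd::finite \<Rightarrow> real"
  assumes f: "vanishes_at_infinity f" and k: "1 \<le> k" "k \<le> l"
    and gap: "kth_largest f l < kth_largest f k"
    and L: "L \<le> kth_largest f l" and U: "kth_largest f k \<le> U"
  shows "\<exists>(A :: (int ^ 'd) set) F. finite A \<and> card A = k \<and> finite F \<and> F \<subseteq> lattice_edges \<and>
    card (vertex_boundary A) + k < card F + l \<and>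
    (\<forall>e\<in>F. kth_largest f k - kth_largest f l \<le> 2 * edge_diff (\<lambda>x. truncate L U \<bar>f x\<bar>) e)"
proof -
  let ?a = "kth_largest f k" and ?b = "kth_largest f l"
  define t u where "t = ?a - (?a - ?b) / 4" and "u = ?b + (?a - ?b) / 4"
  have tu: "?b < u" "u < t" "t < ?a" "?a - ?b \<le> 2 * (t - u)"
    using gap by (auto simp: t_def u_def field_simps)
  have u0: "0 < u" using tu kth_largest_nonneg[OF f, of l] k by linarith
  define B where "B = {x. u < \<bar>f x\<bar>}"
  have B: "finite B" "card B < l"
    using vanishes_at_infinityD[OF f u0] less_kth_largest_iff[OF f _ u0, of l] tu k
    by (auto simp: B_def)
  \<comment> \<open>More than \<open>k\<close> points may lie above \<open>t\<close>, so
    \<open>A\<close> is cut down to exactly \<open>k\<close> of them.\<close>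
  have "k \<le> card {x. t < \<bar>f x\<bar>}"
    using less_kth_largest_iff[OF f k(1), of t] tu u0 by auto
  then obtain A where A: "A \<subseteq> {x. t < \<bar>f x\<bar>}" "card A = k" "finite A"
    by (rule obtain_subset_with_card_n)
  then have "A \<subseteq> B" using tu by (auto simp: B_def)
  from boundary_edges[OF A(3) B(1) this] obtain F
    where F: "F \<subseteq> lattice_edges" "finite F" "card (vertex_boundary A) + card A \<le> card F + card B"
      "\<And>e. e \<in> F \<Longrightarrow> \<exists>x\<in>A. \<exists>y. y \<notin> B \<and> e = {x, y}" by metis
  have diff: "?a - ?b \<le> 2 * edge_diff (\<lambda>x. truncate L U \<bar>f x\<bar>) e" if e: "e \<in> F" for e
  proof -
    obtain x y where xy: "x \<in> A" "y \<notin> B" "e = {x, y}" using F(4)[OF e] by blast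
    then have "t < \<bar>f x\<bar>" "\<bar>f y\<bar> \<le> u" using A by (auto simp: B_def)
    then have "t \<le> truncate L U \<bar>f x\<bar>" "truncate L U \<bar>f y\<bar> \<le> u"
      using tu L U by (auto simp: truncate_def)
    then show ?thesis using tu xy by (simp add: edge_diff_pair)
  qed
  show ?thesis using A(2,3) B(2) F(1-3) diff by (intro exI[of _ A] exI[of _ F]) auto
qed

text \<open>The number of steps from one ball to the next: the sphere between them has at most
  \<open>2 * 3 ^ (CARD('d) - 1) * W\<close> points, with
  \<open>W = (s + 1) ^ (CARD('d) - 1)\<close>, and a step takes at least
  \<open>W / (2 * iso_const TYPE('d))\<close> of them.\<close>

definition step_const :: "'d::finite itself \<Rightarrow> nat" where
  "step_const _ = 4 * iso_const TYPE('d) * 3 ^ (CARD('d) - 1)"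

lemma step_const_pos: "0 < step_const TYPE('d::finite)"
  using iso_const_pos[where 'd = 'd] by (simp add: step_const_def)

lemma card_l1_sphere_le':
  assumes "r \<le> s + 1"
  shows "card (l1_sphere r :: (int ^ 'd::finite) set)
    \<le> 2 * 3 ^ (CARD('d) - 1) * (s + 1) ^ (CARD('d) - 1)"
proof -
  have "(2 * r + 1) ^ (CARD('d) - 1) \<le> (3 * (s + 1)) ^ (CARD('d) - 1)"
    using assms by (intro power_mono) auto
  also have "\<dots> = 3 ^ (CARD('d) - 1) * (s + 1) ^ (CARD('d) - 1)" by (rule power_mult_distrib)
  finally show ?thesis
    using card_l1_sphere_le[where 'd = 'd, of r] unfolding mult.assoc by linarith
qed

text \<open>Passing from the ball of radius \<open>s\<close> to the next one in a bounded number of steps, each at most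
  half as long as the vertex boundaries of the sets in between, one of the steps takes up a fixed
  proportion of the total drop.\<close>

lemma shell_gap_edges:
  fixes f :: "int ^ 'd::finite \<Rightarrow> real"
  assumes f: "vanishes_at_infinity f" and gap: "shell_value f (s + 1) < shell_value f s"
  shows "\<exists>F \<subseteq> lattice_edges. finite F \<and>
    (s + 1) ^ (CARD('d) - 1) \<le> 2 * iso_const TYPE('d) * card F \<and>
    (\<forall>e\<in>F. shell_value f s - shell_value f (s + 1) \<le> 2 * step_const TYPE('d) *
      edge_diff (\<lambda>x. truncate (shell_value f (s + 1)) (shell_value f s) \<bar>f x\<bar>) e)"
proof -
  define Q where "Q = iso_const TYPE('d)"
  define N where "N = step_const TYPE('d)"
  define W where "W = (s + 1) ^ (CARD('d) - 1)"
  define b0 b1 where "b0 = card (l1_ball s :: (int ^ 'd) set)"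
    and "b1 = card (l1_ball (s + 1) :: (int ^ 'd) set)"
  \<comment> \<open>The step length is rounded up so that \<open>N\<close> steps reach
    \<open>b1\<close>, while \<open>h - 1\<close> is still at most half of the lower bound
    \<open>W / Q\<close> for a boundary.\<close>
  define h where "h = W div (2 * Q) + 1"
  have Q: "Q > 0" and N: "N > 0" by (simp_all add: Q_def N_def iso_const_pos step_const_pos)
  have "W = 2 * Q * (h - 1) + W mod (2 * Q)" "2 * Q * h = 2 * Q * (h - 1) + 2 * Q"
    by (simp_all add: h_def)
  then have Wh: "2 * Q * (h - 1) \<le> W" "W \<le> 2 * Q * h"
    using mod_less_divisor[of "2 * Q" W] Q by linarith+
  have b: "1 \<le> b0" "b0 \<le> b1"
    by (auto simp only: b0_def b1_def intro!: card_l1_ball_mono one_le_card_l1_ball)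
  have "b1 \<le> b0 + 2 * 3 ^ (CARD('d) - 1) * W"
    using card_l1_ball_Suc[where 'd = 'd, of s] card_l1_sphere_le'[where 'd = 'd, of "s + 1" s]
    by (simp add: b0_def b1_def W_def)
  also have "\<dots> \<le> b0 + 2 * 3 ^ (CARD('d) - 1) * (2 * Q * h)"
    using Wh by (intro add_left_mono mult_left_mono) auto
  also have "\<dots> = b0 + N * h" by (simp add: N_def step_const_def Q_def)
  finally have b1: "b1 \<le> b0 + N * h" .
  \<comment> \<open>Steps beyond \<open>b1\<close> are cut off and contribute nothing to the
    telescoping sum.\<close>
  define k where "k j = min (b0 + j * h) b1" for j
  let ?a = "kth_largest f"
  let ?D = "shell_value f s - shell_value f (s + 1)"
  have D: "?D = ?a b0 - ?a b1" by (simp add: shell_value_def b0_def b1_def)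
  have "(\<Sum>j<N. ?a (k j) - ?a (k (Suc j))) = ?a (k 0) - ?a (k N)" by (rule sum_lessThan_telescope')
  also have "\<dots> = ?D" using b b1 unfolding D k_def by (simp add: min_absorb1 min_absorb2)
  finally have sum: "(\<Sum>j<N. ?a (k j) - ?a (k (Suc j))) = ?D" .
  obtain j where j: "j < N" "?D / N \<le> ?a (k j) - ?a (k (Suc j))"
  proof (rule ccontr)
    assume "\<not> thesis"
    then have "\<And>j. j < N \<Longrightarrow> ?a (k j) - ?a (k (Suc j)) < ?D / N" using that by force
    then have "(\<Sum>j<N. ?a (k j) - ?a (k (Suc j))) < (\<Sum>j<N. ?D / N)"
      using N by (intro sum_strict_mono) auto
    then show False using sum N by simp
  qed
  have "0 < ?D / N" using gap N by simp
  then have gap': "?a (k (Suc j)) < ?a (k j)" using j by linarith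
  have k: "b0 \<le> k j" "k j \<le> k (Suc j)" "k (Suc j) \<le> b1" "k (Suc j) \<le> k j + h"
    using b by (auto simp: k_def)
  have "shell_value f (s + 1) \<le> ?a (k (Suc j))" "?a (k j) \<le> shell_value f s"
    unfolding shell_value_def b0_def[symmetric] b1_def[symmetric]
    using k b by (auto intro!: kth_largest_antimono f)
  from level_gap_edges[OF f _ k(2) gap' this] k b
  obtain A :: "(int ^ 'd) set" and F where AF: "finite A" "card A = k j" "finite F" "F \<subseteq> lattice_edges"
    "card (vertex_boundary A) + k j < card F + k (Suc j)"
    "\<And>e. e \<in> F \<Longrightarrow> ?a (k j) - ?a (k (Suc j)) \<le> 2 * edge_diff
      (\<lambda>x. truncate (shell_value f (s + 1)) (shell_value f s) \<bar>f x\<bar>) e" by auto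
  have "W \<le> Q * card (vertex_boundary A)"
    unfolding W_def Q_def
    by (rule card_vertex_boundary_ge) (use AF k in \<open>auto simp: b0_def b1_def\<close>)
  \<comment> \<open>The strict inequality in \<open>AF(5)\<close> gives \<open>h - 1\<close> in
    place of \<open>h\<close>. This matters when \<open>W\<close> is small and \<open>h = 1\<close>:
    no boundary vertex is lost then.\<close>
  moreover have "card (vertex_boundary A) \<le> card F + (h - 1)" using AF(5) k by linarith
  then have "2 * Q * card (vertex_boundary A) \<le> 2 * Q * card F + 2 * Q * (h - 1)"
    by (metis add_mult_distrib2 mult_le_mono2)
  ultimately have "W \<le> 2 * Q * card F" using Wh(1) by linarith
  moreover have "?D \<le> 2 * N *
    edge_diff (\<lambda>x. truncate (shell_value f (s + 1)) (shell_value f s) \<bar>f x\<bar>) e" if "e \<in> F" for e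
  proof -
    have "?D / N \<le> 2 * edge_diff
      (\<lambda>x. truncate (shell_value f (s + 1)) (shell_value f s) \<bar>f x\<bar>) e"
      using j(2) AF(6)[OF that] by linarith
    then show ?thesis using N by (simp add: field_simps)
  qed
  ultimately show ?thesis
    using AF(3,4) unfolding W_def Q_def N_def by (intro exI[of _ F]) auto
qed

section \<open>Edges of the rearrangement by height\<close>

definition shell_edges :: "nat \<Rightarrow> (int ^ 'd::finite) set set" where
  "shell_edges s = {e \<in> lattice_edges. \<exists>x\<in>e. l1_norm x = int s \<or> l1_norm x = int s + 1}"

lemma card_shell_edges_le:
  "finite (shell_edges s :: (int ^ 'd::finite) set set)"
  "card (shell_edges s :: (int ^ 'd::finite) set set)
    \<le> 8 * 3 ^ (CARD('d) - 1) * 3 ^ (CARD('d) - 1) * (s + 1) ^ (CARD('d) - 1)"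
proof -
  let ?V = "l1_sphere s \<union> l1_sphere (s + 1) :: (int ^ 'd) set"
  let ?U = "l1_sphere 1 :: (int ^ 'd) set"
  have sub: "(shell_edges s :: (int ^ 'd) set set) \<subseteq> (\<lambda>(x, u). {x, x - u}) ` (?V \<times> ?U)"
  proof
    fix e :: "(int ^ 'd) set" assume "e \<in> shell_edges s"
    then obtain x y where xy: "e = {x, y}" "l1_norm (x - y) = 1" "x \<in> ?V"
      unfolding shell_edges_def lattice_edges_def l1_sphere_def
      by (fastforce simp: l1_norm_minus_commute insert_commute)
    then show "e \<in> (\<lambda>(x, u). {x, x - u}) ` (?V \<times> ?U)"
      by (intro image_eqI[of _ _ "(x, x - y)"]) (auto simp: l1_sphere_def)
  qed
  then show "finite (shell_edges s :: (int ^ 'd::finite) set set)" by (rule finite_subset) simp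
  let ?T = "3 ^ (CARD('d) - 1) :: nat" and ?W = "(s + 1) ^ (CARD('d) - 1)"
  have "card (shell_edges s :: (int ^ 'd) set set) \<le> card (?V \<times> ?U)"
    using sub by (rule surj_card_le[rotated]) simp
  also have "\<dots> = card ?V * card ?U" by (rule card_cartesian_product)
  also have "card ?V \<le> card (l1_sphere s :: (int ^ 'd) set) + card (l1_sphere (s + 1) :: (int ^ 'd) set)"
    by (rule card_Un_le)
  also have "\<dots> \<le> 2 * ?T * ?W + 2 * ?T * ?W"
    by (intro add_mono card_l1_sphere_le') auto
  also have "card ?U \<le> 2 * ?T" using card_l1_sphere_le'[where 'd = 'd, of 1 0] by simp
  finally show "card (shell_edges s :: (int ^ 'd) set set) \<le> 8 * ?T * ?T * ?W"
    by (simp add: algebra_simps)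
qed

text \<open>The points listed up to \<open>v k\<close> have no larger norm, so all \<open>k\<close>
  of them lie in the ball. In the next lemma, conversely, the whole ball is listed before
  \<open>v k\<close>.\<close>

lemma l1_enumeration_index_le:
  fixes v :: "nat \<Rightarrow> int ^ 'd::finite"
  assumes v: "l1_enumeration v" and k: "1 \<le> k" and r: "l1_norm (v k) \<le> int r"
  shows "k \<le> card (l1_ball r :: (int ^ 'd) set)"
proof -
  have inj: "inj_on v {1..}" using v by (simp add: l1_enumeration_def bij_betw_def)
  have "v ` {1..k} \<subseteq> l1_ball r"
  proof (clarsimp simp: l1_ball_def)
    fix i assume "Suc 0 \<le> i" "i \<le> k"
    then have "\<not> l1_norm (v k) < l1_norm (v i)" using v k unfolding l1_enumeration_def by (metis One_nat_def leD)
    with r show "l1_norm (v i) \<le> int r" by linarith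
  qed
  then have "card (v ` {1..k}) \<le> card (l1_ball r :: (int ^ 'd) set)" by (intro card_mono) auto
  then show ?thesis by (subst (asm) card_image) (auto intro: inj_on_subset[OF inj])
qed

lemma l1_enumeration_index_gt:
  fixes v :: "nat \<Rightarrow> int ^ 'd::finite"
  assumes v: "l1_enumeration v" and k: "1 \<le> k" and r: "int r < l1_norm (v k)"
  shows "card (l1_ball r :: (int ^ 'd) set) < k"
proof -
  have "l1_ball r \<subseteq> v ` {1..<k}"
  proof
    fix x :: "int ^ 'd" assume x: "x \<in> l1_ball r"
    have "x \<in> v ` {1..}" using v by (simp add: l1_enumeration_def bij_betw_def)
    then obtain i where "1 \<le> i" "x = v i" by auto
    moreover have "i < k" using v k r x calculation by (auto simp: l1_enumeration_def l1_ball_def)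
    ultimately show "x \<in> v ` {1..<k}" by auto
  qed
  then have "card (l1_ball r :: (int ^ 'd) set) \<le> card {1..<k}" by (intro surj_card_le) auto
  with k show ?thesis by auto
qed

text \<open>Both endpoint values lie between \<open>shell_value f (r + 1)\<close> and
  \<open>shell_value f (r - 1)\<close>. This range consists of two consecutive drops, and the factor
  2 allows the edge to be charged to the larger one.\<close>

lemma rearrangement_edge_diff_le:
  fixes v :: "nat \<Rightarrow> int ^ 'd::finite"
  assumes v: "l1_enumeration v" and f: "vanishes_at_infinity f" and e: "e \<in> lattice_edges"
  shows "\<exists>s. e \<in> shell_edges s \<and>
    edge_diff (rearrangement v f) e \<le> 2 * (shell_value f s - shell_value f (s + 1))"
proof -
  obtain x y where xy: "e = {x, y}" "l1_norm (x - y) = 1" "l1_norm x \<le> l1_norm y"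
    using e unfolding lattice_edges_def
    by clarsimp (metis insert_commute l1_norm_minus_commute linorder_le_cases)
  define r where "r = nat (l1_norm x)"
  have r: "l1_norm x = int r" by (simp add: r_def)
  have "l1_norm y \<le> l1_norm x + l1_norm (y - x)" using l1_norm_triangle[of x "y - x"] by simp
  then have y: "int r \<le> l1_norm y" "l1_norm y \<le> int (r + 1)"
    using xy r by (auto simp: l1_norm_minus_commute)
  let ?f = "rearrangement v f"
  have bounds: "shell_value f (r + 1) \<le> ?f z \<and> ?f z \<le> shell_value f (r - 1)"
    if z: "int r \<le> l1_norm z" "l1_norm z \<le> int (r + 1)" for z
  proof -
    have "z \<in> v ` {1..}" using v by (simp add: l1_enumeration_def bij_betw_def)
    then obtain k where k: "1 \<le> k" "z = v k" by auto
    have fz: "?f z = kth_largest f k" using rearrangement_enum[OF v k(1)] k by simp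
    have "k \<le> card (l1_ball (r + 1) :: (int ^ 'd) set)"
      using l1_enumeration_index_le[OF v k(1)] z k by blast
    then have "shell_value f (r + 1) \<le> ?f z"
      unfolding fz shell_value_def by (rule kth_largest_antimono[OF f k(1)])
    moreover have "card (l1_ball (r - 1) :: (int ^ 'd) set) \<le> k"
    proof (cases r)
      \<comment> \<open>Here \<open>r - 1\<close> is 0 and the ball is a single point, so the claim
        is \<open>1 \<le> k\<close>.\<close>
      case 0
      then show ?thesis using k by (simp add: card_l1_ball_0)
    next
      case (Suc q)
      then show ?thesis using l1_enumeration_index_gt[OF v k(1), of q] z k by simp
    qed
    then have "?f z \<le> shell_value f (r - 1)"
      unfolding fz shell_value_def by (rule kth_largest_antimono[OF f one_le_card_l1_ball])
    ultimately show ?thesis by simp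
  qed
  have diff: "edge_diff ?f e \<le> shell_value f (r - 1) - shell_value f (r + 1)"
    using bounds[of x] bounds[of y] r y unfolding xy(1) edge_diff_pair by auto
  have er: "e \<in> shell_edges r" using e xy r by (auto simp: shell_edges_def)
  show ?thesis
  proof (cases r)
    case 0
    with diff er shell_value_antimono[OF f, of 0 1] show ?thesis by (intro exI[of _ 0]) auto
  next
    case (Suc q)
    have eq: "e \<in> shell_edges q" using e xy r Suc by (auto simp: shell_edges_def)
    show ?thesis
    proof (cases "shell_value f q - shell_value f r \<le> shell_value f r - shell_value f (r + 1)")
      case True
      with diff er Suc show ?thesis by (intro exI[of _ r]) auto
    next
      case False
      with diff eq Suc show ?thesis by (intro exI[of _ q]) auto
    qed
  qed
qed

section \<open>Truncation slices\<close>

text \<open>The intervals from \<open>b (Suc s)\<close> to \<open>b s\<close> are stacked without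
  overlap. For ordered arguments the increments have one sign and telescope to that of the
  truncation to the whole range, which is 1-Lipschitz.\<close>

lemma sum_truncate_diff_le:
  assumes b: "\<And>s. b (Suc s) \<le> b s"
  shows "(\<Sum>s<n. \<bar>truncate (b (Suc s)) (b s) x - truncate (b (Suc s)) (b s) y\<bar>) \<le> \<bar>x - y\<bar>"
proof (induction x y rule: linorder_wlog)
  case (le x y)
  have b0: "b n \<le> b 0" for n
    by (induction n) (auto intro: order.trans[OF b])
  have "(\<Sum>s<n. truncate (b (Suc s)) (b s) y - truncate (b (Suc s)) (b s) x)
      = truncate (b n) (b 0) y - truncate (b n) (b 0) x" for n
  proof (induction n)
    case (Suc n)
    show ?case unfolding sum.lessThan_Suc Suc
      using b[of n] b0[of n] by (auto simp: truncate_def max_def min_def)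
  qed (simp add: truncate_def)
  moreover have "(\<Sum>s<n. \<bar>truncate (b (Suc s)) (b s) x - truncate (b (Suc s)) (b s) y\<bar>)
      = (\<Sum>s<n. truncate (b (Suc s)) (b s) y - truncate (b (Suc s)) (b s) x)"
    using le by (intro sum.cong) (auto simp: truncate_def)
  ultimately show ?case using le b0[of n] by (auto simp: truncate_def)
next
  case (sym x y)
  then show ?case by (simp add: abs_minus_commute)
qed

text \<open>Passing from \<open>f\<close> to \<open>|f|\<close> is covered by the reverse triangle
  inequality.\<close>

lemma edge_diff_truncate_sum_le:
  assumes b: "\<And>s. b (Suc s) \<le> b s" and e: "e \<in> lattice_edges"
  shows "(\<Sum>s<n. edge_diff (\<lambda>x. truncate (b (Suc s)) (b s) \<bar>f x\<bar>) e) \<le> edge_diff f e"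
proof -
  obtain x y where "e = {x, y}" using e by (auto simp: lattice_edges_def)
  then show ?thesis
    using sum_truncate_diff_le[where b = b and x = "\<bar>f x\<bar>" and y = "\<bar>f y\<bar>" and n = n] b
    by (simp add: edge_diff_pair)
qed

section \<open>Powers and summation over slices\<close>

text \<open>Split off one factor from each power and enlarge the base of the remaining exponent
  \<open>q - 1\<close>, which is nonnegative.\<close>

lemma powr_superadditive:
  fixes x y q :: real
  assumes "0 \<le> x" "0 \<le> y" "1 \<le> q"
  shows "x powr q + y powr q \<le> (x + y) powr q"
proof -
  have split: "z powr q = z * z powr (q - 1)" if "0 \<le> z" for z
    using that powr_mult_base[of z "q - 1"] by simp
  have "x powr q + y powr q \<le> x * (x + y) powr (q - 1) + y * (x + y) powr (q - 1)"
    using assms unfolding split[OF assms(1)] split[OF assms(2)]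
    by (intro add_mono mult_left_mono powr_mono2) auto
  also have "\<dots> = (x + y) powr q" using assms by (simp add: split[of "x + y"] distrib_right)
  finally show ?thesis .
qed

lemma sum_powr_le:
  fixes t :: "nat \<Rightarrow> real"
  assumes t: "\<And>s. 0 \<le> t s" and q: "1 \<le> q"
  shows "(\<Sum>s<n. t s powr q) \<le> (\<Sum>s<n. t s) powr q"
proof (induction n)
  case (Suc n)
  then show ?case
    using powr_superadditive[of "\<Sum>s<n. t s" "t n" q] t q by (simp add: sum_nonneg)
qed simp

lemma ennreal_rpow_mono: "a \<le> b \<Longrightarrow> 0 < r \<Longrightarrow> ennreal_rpow a r \<le> ennreal_rpow b r"
  by (auto simp: ennreal_rpow_def less_top intro!: ennreal_leI powr_mono2 enn2real_mono)

lemma ennreal_rpow_powr_mult: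
  assumes "0 < c" "0 < q"
  shows "ennreal_rpow (ennreal (c powr q) * a) (1 / q) = ennreal c * ennreal_rpow a (1 / q)"
proof (cases a)
  case (real t)
  then show ?thesis
    using assms by (simp add: ennreal_rpow_def ennreal_mult[symmetric] powr_mult powr_powr)
next
  case top
  then show ?thesis using assms by (simp add: ennreal_rpow_def ennreal_mult_top)
qed

text \<open>\<open>D s\<close> controls the gradient of \<open>g\<close> on the edges \<open>G s\<close>; it is in turn controlled, on
  comparably many edges, by the gradient of the slice \<open>h s\<close> of \<open>f\<close>.\<close>

lemma grad_norm_le_of_slices:
  fixes f g :: "int ^ 'd::finite \<Rightarrow> real" and D :: "nat \<Rightarrow> real" and M K :: real
  assumes g: "\<And>e. e \<in> lattice_edges \<Longrightarrow> \<exists>s. e \<in> G s \<and> edge_diff g e \<le> 2 * D s"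
    and D: "\<And>s. 0 \<le> D s"
    and G: "\<And>s. finite (G s)" "\<And>s. G s \<subseteq> lattice_edges"
    and F: "\<And>s. 0 < D s \<Longrightarrow> \<exists>F \<subseteq> lattice_edges. finite F \<and> card (G s) \<le> K * card F \<and>
      (\<forall>e\<in>F. D s \<le> M * edge_diff (h s) e)"
    and h: "\<And>n e. e \<in> lattice_edges \<Longrightarrow> (\<Sum>s<n. edge_diff (h s) e) \<le> edge_diff f e"
    and K: "1 \<le> K" and M: "1 \<le> M" and p: "1 \<le> p"
  shows "grad_norm p g \<le> ennreal (2 * M * K) * grad_norm p f"
proof (cases "p = \<infinity>")
  case True
  have "ennreal (edge_diff g e) \<le> ennreal (2 * M * K) * grad_norm \<infinity> f"
    if e: "e \<in> lattice_edges" for e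
  proof -
    obtain s where s: "e \<in> G s" "edge_diff g e \<le> 2 * D s" using g[OF e] by blast
    show ?thesis
    proof (cases "0 < D s")
      case True
      then obtain F where F': "F \<subseteq> lattice_edges" "finite F" "card (G s) \<le> K * card F"
        "\<And>e. e \<in> F \<Longrightarrow> D s \<le> M * edge_diff (h s) e" using F by metis
      \<comment> \<open>For the supremum a single edge of \<open>F\<close> suffices, and
        \<open>F\<close> is nonempty because \<open>e\<close> lies in \<open>G s\<close>.\<close>
      have "0 < card (G s)" using s G(1)[of s] by (auto simp: card_gt_0_iff)
      then have "F \<noteq> {}" using F'(3) by auto
      then obtain e' where e': "e' \<in> F" by auto
      then have e'E: "e' \<in> lattice_edges" using F' by auto
      have "edge_diff (h s) e' \<le> (\<Sum>s<Suc s. edge_diff (h s) e')"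
        by (rule member_le_sum) (auto intro: edge_diff_nonneg e'E)
      also have "\<dots> \<le> edge_diff f e'" by (rule h[OF e'E])
      finally have "M * edge_diff (h s) e' \<le> M * edge_diff f e'"
        using M by (intro mult_left_mono) auto
      then have "edge_diff g e \<le> 2 * M * edge_diff f e'" using s F'(4)[OF e'] by linarith
      also have "\<dots> \<le> 2 * M * K * edge_diff f e'"
        using K M edge_diff_nonneg[OF e'E, of f] by (intro mult_right_mono) auto
      finally have "ennreal (edge_diff g e) \<le> ennreal (2 * M * K) * ennreal (edge_diff f e')"
        using K M edge_diff_nonneg[OF e'E, of f] by (simp add: ennreal_mult[symmetric] ennreal_leI)
      also have "\<dots> \<le> ennreal (2 * M * K) * grad_norm \<infinity> f"
        using e'E by (intro mult_left_mono) (auto simp: grad_norm_def intro: SUP_upper)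
      finally show ?thesis .
    next
      case False
      then have "ennreal (edge_diff g e) = 0" using s by (simp add: ennreal_eq_0_iff)
      then show ?thesis by simp
    qed
  qed
  then show ?thesis using True by (auto simp: grad_norm_def[of _ g] intro!: SUP_least)
next
  case False
  define q where "q = enn2real p"
  have pq: "p = ennreal q" using False by (simp add: q_def less_top)
  have q: "1 \<le> q" using p unfolding pq by simp
  let ?E = "count_space (lattice_edges :: (int ^ 'd) set set)"
  define \<phi> where "\<phi> g e = ennreal (edge_diff g e powr q)" for g :: "int ^ 'd \<Rightarrow> real" and e
  \<comment> \<open>Integrate the lower bound for the gradient of \<open>h s\<close> over
    \<open>F\<close>, then exchange \<open>card F\<close> for \<open>card (G s)\<close> at the cost
    of \<open>K\<close>.\<close>
  have slice: "ennreal (D s powr q) * card (G s) \<le> ennreal (K * M powr q) * (\<integral>\<^sup>+ e. \<phi> (h s) e \<partial>?E)"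
    for s
  proof (cases "0 < D s")
    case True
    then obtain F where F': "F \<subseteq> lattice_edges" "finite F" "card (G s) \<le> K * card F"
      "\<And>e. e \<in> F \<Longrightarrow> D s \<le> M * edge_diff (h s) e" using F by metis
    have "ennreal (D s powr q) * card F = (\<integral>\<^sup>+ e. ennreal (D s powr q) * indicator F e \<partial>?E)"
      using F' by (subst nn_integral_cmult_indicator) (auto simp: emeasure_count_space_finite)
    also have "\<dots> \<le> (\<integral>\<^sup>+ e. ennreal (M powr q) * \<phi> (h s) e \<partial>?E)"
    proof (rule nn_integral_mono)
      fix e assume "e \<in> space ?E"
      then have e: "0 \<le> edge_diff (h s) e" by (auto intro: edge_diff_nonneg)
      have "D s powr q \<le> M powr q * edge_diff (h s) e powr q" if "e \<in> F"
        using F'(4)[OF that] D[of s] e M q by (subst powr_mult[symmetric]) (auto intro: powr_mono2)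
      then show "ennreal (D s powr q) * indicator F e \<le> ennreal (M powr q) * \<phi> (h s) e"
        by (auto simp: \<phi>_def indicator_def ennreal_mult[symmetric] intro: ennreal_leI)
    qed
    also have "\<dots> = ennreal (M powr q) * (\<integral>\<^sup>+ e. \<phi> (h s) e \<partial>?E)"
      by (rule nn_integral_cmult) simp
    finally have *: "ennreal (D s powr q) * card F \<le> ennreal (M powr q) * (\<integral>\<^sup>+ e. \<phi> (h s) e \<partial>?E)" .
    have "ennreal (card (G s)) \<le> ennreal K * ennreal (card F)"
      using F'(3) K by (simp add: ennreal_mult[symmetric] ennreal_leI)
    then have "ennreal (D s powr q) * card (G s) \<le> ennreal (D s powr q) * (ennreal K * card F)"
      by (intro mult_left_mono) (auto simp: ennreal_of_nat_eq_real_of_nat)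
    also have "\<dots> = ennreal K * (ennreal (D s powr q) * card F)" by (simp add: ac_simps)
    also have "\<dots> \<le> ennreal K * (ennreal (M powr q) * (\<integral>\<^sup>+ e. \<phi> (h s) e \<partial>?E))"
      using * by (rule mult_left_mono) simp
    finally show ?thesis using K by (simp add: ennreal_mult mult.assoc)
  next
    case False
    then have "D s = 0" using D[of s] by simp
    then show ?thesis by simp
  qed
  \<comment> \<open>Every edge is charged to at least one shell; counting it in several only
    enlarges the right side.\<close>
  have "(\<integral>\<^sup>+ e. \<phi> g e \<partial>?E) \<le> (\<integral>\<^sup>+ e. (\<Sum>s. ennreal ((2 * D s) powr q) * indicator (G s) e) \<partial>?E)"
  proof (rule nn_integral_mono)
    fix e assume "e \<in> space ?E"
    then have e: "e \<in> lattice_edges" by simp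
    obtain s where s: "e \<in> G s" "edge_diff g e \<le> 2 * D s" using g[OF e] by blast
    define u where "u = (\<lambda>s. ennreal ((2 * D s) powr q) * indicator (G s) e)"
    have "\<phi> g e \<le> ennreal ((2 * D s) powr q)"
      unfolding \<phi>_def using s q edge_diff_nonneg[OF e, of g] by (intro ennreal_leI powr_mono2) auto
    also have "\<dots> = u s" using s by (simp add: u_def)
    also have "\<dots> \<le> suminf u" using sum_le_suminf[of u "{s}"] by simp
    finally show "\<phi> g e \<le> (\<Sum>s. ennreal ((2 * D s) powr q) * indicator (G s) e)"
      unfolding u_def .
  qed
  also have "\<dots> = (\<Sum>s. \<integral>\<^sup>+ e. ennreal ((2 * D s) powr q) * indicator (G s) e \<partial>?E)"
    by (rule nn_integral_suminf) simp
  also have "\<dots> = (\<Sum>s. ennreal (2 powr q) * (ennreal (D s powr q) * card (G s)))"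
  proof (rule suminf_cong)
    fix s
    have "(\<integral>\<^sup>+ e. ennreal ((2 * D s) powr q) * indicator (G s) e \<partial>?E)
        = ennreal ((2 * D s) powr q) * card (G s)"
      using G by (subst nn_integral_cmult_indicator) (auto simp: emeasure_count_space_finite)
    then show "(\<integral>\<^sup>+ e. ennreal ((2 * D s) powr q) * indicator (G s) e \<partial>?E)
        = ennreal (2 powr q) * (ennreal (D s powr q) * card (G s))"
      using D by (simp add: powr_mult ennreal_mult mult.assoc)
  qed
  also have "\<dots> \<le> (\<Sum>s. ennreal (2 powr q) * (ennreal (K * M powr q) * (\<integral>\<^sup>+ e. \<phi> (h s) e \<partial>?E)))"
    by (intro suminf_le mult_left_mono slice) auto
  also have "\<dots> = ennreal (2 powr q * (K * M powr q)) * (\<integral>\<^sup>+ e. (\<Sum>s. \<phi> (h s) e) \<partial>?E)"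
    using K by (subst nn_integral_suminf) (simp_all add: ennreal_mult mult.assoc)
  also have "\<dots> \<le> ennreal ((2 * M * K) powr q) * (\<integral>\<^sup>+ e. \<phi> f e \<partial>?E)"
  proof (rule mult_mono)
    \<comment> \<open>As \<open>K\<close> and \<open>q\<close> are at least 1, \<open>K\<close> may
      be replaced by \<open>K powr q\<close>; taking the root then leaves a constant independent of
      \<open>q\<close>.\<close>
    have "K powr 1 \<le> K powr q" using K q by (intro powr_mono) auto
    then have "2 powr q * (K * M powr q) \<le> 2 powr q * (K powr q * M powr q)"
      using K by (intro mult_left_mono mult_right_mono) auto
    then show "ennreal (2 powr q * (K * M powr q)) \<le> ennreal ((2 * M * K) powr q)"
      using K M by (intro ennreal_leI) (simp add: powr_mult ac_simps)
    show "(\<integral>\<^sup>+ e. (\<Sum>s. \<phi> (h s) e) \<partial>?E) \<le> (\<integral>\<^sup>+ e. \<phi> f e \<partial>?E)"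
    proof (rule nn_integral_mono)
      fix e assume "e \<in> space ?E"
      then have e: "e \<in> lattice_edges" by simp
      \<comment> \<open>Superadditivity of the power lets the slices be recombined on each edge
        without a further constant.\<close>
      have "(\<Sum>s<n. \<phi> (h s) e) \<le> \<phi> f e" for n
      proof -
        have "(\<Sum>s<n. edge_diff (h s) e powr q) \<le> (\<Sum>s<n. edge_diff (h s) e) powr q"
          by (rule sum_powr_le[OF edge_diff_nonneg[OF e] q])
        also have "\<dots> \<le> edge_diff f e powr q"
          using q h[OF e] by (intro powr_mono2) (auto intro!: sum_nonneg edge_diff_nonneg e)
        finally show ?thesis
          unfolding \<phi>_def by (subst sum_ennreal) (auto intro: ennreal_leI)
      qed
      then show "(\<Sum>s. \<phi> (h s) e) \<le> \<phi> f e" by (intro suminf_le_const) auto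
    qed
  qed auto
  finally have "ennreal_rpow (\<integral>\<^sup>+ e. \<phi> g e \<partial>?E) (1 / q)
      \<le> ennreal_rpow (ennreal ((2 * M * K) powr q) * (\<integral>\<^sup>+ e. \<phi> f e \<partial>?E)) (1 / q)"
    using q by (intro ennreal_rpow_mono) auto
  also have "\<dots> = ennreal (2 * M * K) * ennreal_rpow (\<integral>\<^sup>+ e. \<phi> f e \<partial>?E) (1 / q)"
    using K M q by (intro ennreal_rpow_powr_mult) auto
  finally show ?thesis using False by (simp add: grad_norm_def \<phi>_def q_def)
qed

theorem corollary5p1:
  shows "\<exists>c::real. c > 0 \<and>
    (\<forall>v :: nat \<Rightarrow> int ^ 'd::finite. l1_enumeration v \<longrightarrow>
      (\<forall>p::ennreal. 1 \<le> p \<longrightarrow>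
        (\<forall>f :: int ^ 'd \<Rightarrow> real. vanishes_at_infinity f \<longrightarrow>
          grad_norm p (rearrangement v f) \<le> ennreal c * grad_norm p f)))"
proof -
  define Q where "Q = iso_const TYPE('d)"
  \<comment> \<open>\<open>M\<close> compares a shell drop with the gradient of its slice.
    \<open>K\<close> compares edge counts: the bound for \<open>shell_edges\<close> times the factor
    \<open>2 * Q\<close> from \<open>shell_gap_edges\<close>.\<close>
  define M where "M = 2 * step_const TYPE('d)"
  define K where "K = 8 * 3 ^ (CARD('d) - 1) * 3 ^ (CARD('d) - 1) * (2 * Q)"
  have MK: "1 \<le> M" "1 \<le> K"
    using step_const_pos[where 'd = 'd] iso_const_pos[where 'd = 'd]
    by (auto simp: M_def K_def Q_def Suc_le_eq)
  have "grad_norm p (rearrangement v f) \<le> ennreal (2 * real M * real K) * grad_norm p f"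
    if v: "l1_enumeration v" and p: "1 \<le> p" and f: "vanishes_at_infinity f"
    for v :: "nat \<Rightarrow> int ^ 'd" and p and f :: "int ^ 'd \<Rightarrow> real"
  proof (rule grad_norm_le_of_slices)
    let ?b = "shell_value f"
    let ?h = "\<lambda>s x. truncate (?b (Suc s)) (?b s) \<bar>f x\<bar>"
    have b: "?b (Suc s) \<le> ?b s" for s by (rule shell_value_antimono[OF f]) simp
    show "\<exists>s. e \<in> shell_edges s \<and> edge_diff (rearrangement v f) e \<le> 2 * (?b s - ?b (Suc s))"
      if "e \<in> lattice_edges" for e
      using rearrangement_edge_diff_le[OF v f that] by simp
    show "0 \<le> ?b s - ?b (Suc s)" for s using b[of s] by simp
    show "finite (shell_edges s :: (int ^ 'd) set set)" for s by (rule card_shell_edges_le)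
    show "shell_edges s \<subseteq> (lattice_edges :: (int ^ 'd) set set)" for s
      by (auto simp: shell_edges_def)
    show "\<exists>F \<subseteq> lattice_edges. finite F \<and>
        real (card (shell_edges s :: (int ^ 'd) set set)) \<le> real K * real (card F) \<and>
        (\<forall>e\<in>F. ?b s - ?b (Suc s) \<le> real M * edge_diff (?h s) e)"
      if gap: "0 < ?b s - ?b (Suc s)" for s
    proof -
      obtain F where F: "F \<subseteq> lattice_edges" "finite F"
        "(s + 1) ^ (CARD('d) - 1) \<le> 2 * Q * card F"
        "\<forall>e\<in>F. ?b s - ?b (Suc s) \<le> real M * edge_diff (?h s) e"
        using shell_gap_edges[OF f, of s] gap by (auto simp: M_def Q_def)
      have "card (shell_edges s :: (int ^ 'd) set set) \<le> K * card F"
        using order.trans[OF card_shell_edges_le(2) mult_left_mono[OF F(3)]]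
        by (simp add: K_def mult.assoc)
      then have "real (card (shell_edges s :: (int ^ 'd) set set)) \<le> real K * real (card F)"
        unfolding of_nat_mult[symmetric] by (rule of_nat_mono)
      with F show ?thesis by blast
    qed
    show "(\<Sum>s<n. edge_diff (?h s) e) \<le> edge_diff f e" if "e \<in> lattice_edges" for n e
      using b that by (rule edge_diff_truncate_sum_le)
    show "1 \<le> real K" "1 \<le> real M" using MK by auto
  qed (rule p)
  moreover have "0 < 2 * real M * real K" using MK by simp
  ultimately show ?thesis by (intro exI[of _ "2 * real M * real K"]) simp
qed

end
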